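(* Let $(X,\|\cdot\|)$ be a real Banach space which admits an equivalent Gâteaux smooth norm and which has a complemented subspace isomorphic to $\ell_1$. Then $X$ admits an equivalent norm $|||\cdot|||$ which is simultaneously octahedral and Gâteaux smooth.
   Context: A norm on a real normed space $X$ is Gâteaux smooth if it is Gâteaux differentiable at every $x\in X\setminus\{0\}$. A norm $\|\cdot\|$ on a Banach space $X$ is octahedral if for every $\varepsilon>0$ and every finite-dimensional subspace $F$ of $X$ there exists $x\in X$ with $\|x\|=1$ such that $\|y+\alpha x\|\ge(1-\varepsilon)(\|y\|+|\alpha|)$ for every $y\in F$ and every $\alpha\in\mathbb{R}$. A subspace is complemented if it is the range of a bounded linear projection on $X$. *)

theory Defs
  imports "HOL-Analysis.Analysis"
begin

section \<open>Equivalent norms\<close>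

text \<open>The given norm of the space is the one of its type class. Further norms on the same vector space are
  functions into the reals; nonnegativity follows from the axioms.\<close>

definition is_norm :: "('a::real_vector \<Rightarrow> real) \<Rightarrow> bool" where
  "is_norm N \<longleftrightarrow>
     (\<forall>x. N x = 0 \<longleftrightarrow> x = 0) \<and>
     (\<forall>x y. N (x + y) \<le> N x + N y) \<and>
     (\<forall>a x. N (a *\<^sub>R x) = \<bar>a\<bar> * N x)"

definition equivalent_norm :: "('a::real_normed_vector \<Rightarrow> real) \<Rightarrow> bool" where
  "equivalent_norm N \<longleftrightarrow>
     is_norm N \<and> (\<exists>c>0. \<exists>C>0. \<forall>x. c * norm x \<le> N x \<and> N x \<le> C * norm x)"


section \<open>Gateaux smooth norms\<close>

definition gateaux_differentiable ::
    "('a::real_normed_vector \<Rightarrow> 'b::real_normed_vector) \<Rightarrow> 'a \<Rightarrow> bool" where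
  "gateaux_differentiable f x \<longleftrightarrow>
     (\<exists>L. bounded_linear L \<and>
        (\<forall>h. ((\<lambda>t. (f (x + t *\<^sub>R h) - f x) /\<^sub>R t) \<longlongrightarrow> L h) (at 0)))"

text \<open>Boundedness of the derivative refers to the norm of the type class. For an equivalent norm
  \<^term>\<open>N\<close> this is the same as boundedness with respect to \<^term>\<open>N\<close>.\<close>

definition gateaux_smooth :: "('a::real_normed_vector \<Rightarrow> real) \<Rightarrow> bool" where
  "gateaux_smooth N \<longleftrightarrow> (\<forall>x. x \<noteq> 0 \<longrightarrow> gateaux_differentiable N x)"


section \<open>Octahedral norms\<close>

text \<open>Finite dimension is expressed by a finite spanning set, because \<^const>\<open>dim\<close> is also 0 for
  subspaces of infinite dimension.\<close>

definition octahedral :: "('a::real_vector \<Rightarrow> real) \<Rightarrow> bool" where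
  "octahedral N \<longleftrightarrow>
     (\<forall>\<epsilon>>0. \<forall>F. subspace F \<and> (\<exists>B. finite B \<and> span B = F) \<longrightarrow>
        (\<exists>x. N x = 1 \<and>
           (\<forall>y\<in>F. \<forall>\<alpha>. N (y + \<alpha> *\<^sub>R x) \<ge> (1 - \<epsilon>) * (N y + \<bar>\<alpha>\<bar>))))"


section \<open>The space of absolutely summable real sequences\<close>

typedef ell1 = "{f :: nat \<Rightarrow> real. summable (\<lambda>n. \<bar>f n\<bar>)}"
  by (rule exI[of _ "\<lambda>_. 0"]) simp

setup_lifting type_definition_ell1

instantiation ell1 :: real_vector
begin

lift_definition zero_ell1 :: ell1 is "\<lambda>_. 0" by simp

lift_definition plus_ell1 :: "ell1 \<Rightarrow> ell1 \<Rightarrow> ell1" is "\<lambda>f g n. f n + g n"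
proof -
  fix f g :: "nat \<Rightarrow> real"
  assume "summable (\<lambda>n. \<bar>f n\<bar>)" "summable (\<lambda>n. \<bar>g n\<bar>)"
  then have "summable (\<lambda>n. \<bar>f n\<bar> + \<bar>g n\<bar>)" by (rule summable_add)
  then show "summable (\<lambda>n. \<bar>f n + g n\<bar>)"
    by (rule summable_comparison_test') (simp add: abs_triangle_ineq)
qed

lift_definition uminus_ell1 :: "ell1 \<Rightarrow> ell1" is "\<lambda>f n. - f n" by simp

lift_definition minus_ell1 :: "ell1 \<Rightarrow> ell1 \<Rightarrow> ell1" is "\<lambda>f g n. f n - g n"
proof -
  fix f g :: "nat \<Rightarrow> real"
  assume "summable (\<lambda>n. \<bar>f n\<bar>)" "summable (\<lambda>n. \<bar>g n\<bar>)"
  then have "summable (\<lambda>n. \<bar>f n\<bar> + \<bar>g n\<bar>)" by (rule summable_add)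
  then show "summable (\<lambda>n. \<bar>f n - g n\<bar>)"
    by (rule summable_comparison_test') (simp add: abs_triangle_ineq4)
qed

lift_definition scaleR_ell1 :: "real \<Rightarrow> ell1 \<Rightarrow> ell1" is "\<lambda>a f n. a * f n"
  by (simp add: abs_mult summable_mult)

instance
proof
  fix x y z :: ell1 and a b :: real
  show "x + y + z = x + (y + z)" by transfer (simp add: add.assoc)
  show "x + y = y + x" by transfer (simp add: add.commute)
  show "0 + x = x" by transfer simp
  show "- x + x = 0" by transfer simp
  show "x - y = x + - y" by transfer simp
  show "a *\<^sub>R (x + y) = a *\<^sub>R x + a *\<^sub>R y" by transfer (simp add: distrib_left)
  show "(a + b) *\<^sub>R x = a *\<^sub>R x + b *\<^sub>R x" by transfer (simp add: distrib_right)
  show "a *\<^sub>R b *\<^sub>R x = (a * b) *\<^sub>R x" by transfer (simp add: mult.assoc)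
  show "1 *\<^sub>R x = x" by transfer simp
qed

end

instantiation ell1 :: real_normed_vector
begin

lift_definition norm_ell1 :: "ell1 \<Rightarrow> real" is "\<lambda>f. \<Sum>n. \<bar>f n\<bar>" .

definition dist_ell1 :: "ell1 \<Rightarrow> ell1 \<Rightarrow> real" where
  "dist_ell1 x y = norm (x - y)"

definition sgn_ell1 :: "ell1 \<Rightarrow> ell1" where
  "sgn_ell1 x = x /\<^sub>R norm x"

definition uniformity_ell1 :: "(ell1 \<times> ell1) filter" where
  "uniformity_ell1 = (INF e\<in>{0 <..}. principal {(x, y). dist x y < e})"

definition open_ell1 :: "ell1 set \<Rightarrow> bool" where
  "open_ell1 U \<longleftrightarrow> (\<forall>x\<in>U. eventually (\<lambda>(x', y). x' = x \<longrightarrow> y \<in> U) uniformity)"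

instance
proof
  fix x y :: ell1 and a :: real and U :: "ell1 set"
  show "dist x y = norm (x - y)" by (rule dist_ell1_def)
  show "sgn x = x /\<^sub>R norm x" by (rule sgn_ell1_def)
  show "uniformity = (INF e\<in>{0 <..}. principal {(x :: ell1, y). dist x y < e})"
    by (rule uniformity_ell1_def)
  show "open U \<longleftrightarrow> (\<forall>x\<in>U. eventually (\<lambda>(x', y). x' = x \<longrightarrow> y \<in> U) uniformity)"
    by (rule open_ell1_def)
  show "norm x = 0 \<longleftrightarrow> x = 0"
    by transfer (auto simp: suminf_eq_zero_iff fun_eq_iff)
  show "norm (x + y) \<le> norm x + norm y"
  proof transfer
    fix f g :: "nat \<Rightarrow> real"
    assume f: "summable (\<lambda>n. \<bar>f n\<bar>)" and g: "summable (\<lambda>n. \<bar>g n\<bar>)"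
    have s: "summable (\<lambda>n. \<bar>f n\<bar> + \<bar>g n\<bar>)" using f g by (rule summable_add)
    then have "summable (\<lambda>n. \<bar>f n + g n\<bar>)"
      by (rule summable_comparison_test') (simp add: abs_triangle_ineq)
    then have "(\<Sum>n. \<bar>f n + g n\<bar>) \<le> (\<Sum>n. \<bar>f n\<bar> + \<bar>g n\<bar>)"
      by (intro suminf_le s abs_triangle_ineq)
    also have "\<dots> = (\<Sum>n. \<bar>f n\<bar>) + (\<Sum>n. \<bar>g n\<bar>)"
      by (rule suminf_add[OF f g, symmetric])
    finally show "(\<Sum>n. \<bar>f n + g n\<bar>) \<le> (\<Sum>n. \<bar>f n\<bar>) + (\<Sum>n. \<bar>g n\<bar>)" .
  qed
  show "norm (a *\<^sub>R x) = \<bar>a\<bar> * norm x"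
    by transfer (simp add: abs_mult suminf_mult)
qed

end


section \<open>Complemented subspaces\<close>

definition complemented_subspace :: "'a::real_normed_vector set \<Rightarrow> bool" where
  "complemented_subspace Y \<longleftrightarrow> (\<exists>P. bounded_linear P \<and> P \<circ> P = P \<and> range P = Y)"

definition isomorphic_to_ell1 :: "'a::real_normed_vector set \<Rightarrow> bool" where
  "isomorphic_to_ell1 Y \<longleftrightarrow>
     (\<exists>(T :: ell1 \<Rightarrow> 'a) S. bounded_linear T \<and> homeomorphism UNIV Y T S)"

end

theory Submission
  imports Defs
begin

text \<open>Let \<^term>\<open>T\<close> embed the space \<open>\<ell>\<^sub>1\<close> onto the complemented subspace and let \<^term>\<open>V\<close> be a bounded
  left inverse, with coordinates \<^term>\<open>f n\<close>; let \<open>e n\<close> be the images of the unit vectors. Composing the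
  given smooth norm with the injective operator that multiplies each \<open>e n\<close> by \<open>2\<^sup>-\<^sup>n\<close> and fixes the kernel
  of \<^term>\<open>V\<close> yields a smooth norm \<open>N\<^sub>0\<close>, in general not equivalent, that tends to zero along \<open>e n\<close>. The
  coordinates are put back one by one by
  \<open>N\<^bsub>n+1\<^esub> = (1 - \<delta>\<^sub>n) N\<^sub>n + sqrt (f\<^sub>n\<^sup>2 + (\<delta>\<^sub>n N\<^sub>n)\<^sup>2)\<close> with \<open>\<delta>\<^sub>n = 2\<^sup>-\<^sup>n\<^sup>-\<^sup>1\<close>. Since \<open>N\<^sub>n \<ge> N\<^sub>0 > 0\<close> off the
  origin, the square root is smooth there, and the second differences of the \<open>N\<^sub>n\<close> are controlled
  uniformly, so the increasing limit \<open>N\<close> is Gateaux smooth; it is equivalent to \<open>N\<^sub>0 + \<Sum> \<bar>f\<^sub>n\<bar>\<close>, hence to the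
  norm of the space. As \<open>N\<^sub>n\<close> is small at \<open>e n\<close> while \<open>N\<^bsub>n+1\<^esub> \<ge> (1 - \<delta>\<^sub>n) N\<^sub>n + \<bar>f\<^sub>n\<bar>\<close>, the value of \<open>N\<close> at
  \<open>y + \<alpha> e n\<close> is asymptotically at least \<open>N y + \<bar>\<alpha>\<bar>\<close>, uniformly on bounded sets of a finite-dimensional
  subspace, which makes \<open>N\<close> octahedral.\<close>

section \<open>Finite-dimensional subspaces\<close>

text \<open>Induction on the spanning set. A vector \<open>b\<close> outside \<open>span B\<close>
  has positive distance to it, so on a bounded set the coefficient of \<open>b\<close> is bounded,
  and the ball lies in a continuous image of a compact product.\<close>

lemma compact_span_Int_cball:
  fixes B :: "'a::real_normed_vector set"
  assumes "finite B"
  shows "compact (span B \<inter> cball 0 r)"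
  using assms
proof (induction B arbitrary: r)
  case empty
  have "span {} \<inter> cball 0 r = (if r \<ge> 0 then {0::'a} else {})" by auto
  then show ?case by simp
next
  case (insert b B)
  show ?case
  proof (cases "b \<in> span B")
    case True
    then show ?thesis using insert.IH by (simp add: span_redundant)
  next
    case False
    \<comment> \<open>A convergent sequence is bounded, so it stays in one ball of
      \<open>span B\<close>, which is compact by the induction hypothesis.\<close>
    have "closed (span B)"
      unfolding closed_limpt islimpt_sequential
    proof clarify
      fix v u assume u: "\<forall>n::nat. u n \<in> span B - {v}" and lim: "u \<longlonglongrightarrow> v"
      obtain R where "\<And>n. norm (u n) \<le> R"
        using convergent_imp_Bseq[of u] lim convergentI Bseq_def by metis
      then have "\<forall>n. u n \<in> span B \<inter> cball 0 R" using u by auto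
      then have "v \<in> span B \<inter> cball 0 R"
        using compact_imp_closed[OF insert.IH] lim closed_sequentially by blast
      then show "v \<in> span B" by simp
    qed
    then have d: "infdist b (span B) > 0"
      using False span_zero by (subst infdist_pos_not_in_closed) auto
    define d where "d = infdist b (span B)"
    have coeff: "\<bar>c\<bar> * d \<le> norm (c *\<^sub>R b + z)" if "z \<in> span B" for c z
    proof (cases "c = 0")
      case False
      have "d \<le> dist b (- (z /\<^sub>R c))"
        unfolding d_def using that by (intro infdist_le) (simp add: span_neg span_scale)
      then have "\<bar>c\<bar> * d \<le> norm (c *\<^sub>R (b + z /\<^sub>R c))"
        by (simp add: dist_norm mult_left_mono)
      then show ?thesis using False by (simp add: scaleR_right_distrib)
    qed simp
    define K where "K = (\<lambda>(c, z). c *\<^sub>R b + z) `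
        ({- (r / d)..r / d} \<times> (span B \<inter> cball 0 (r + r / d * norm b)))"
    have "compact K"
      unfolding K_def by (intro compact_continuous_image compact_Times insert.IH compact_Icc)
        (auto intro!: continuous_intros simp: case_prod_unfold)
    moreover have "span (insert b B) \<inter> cball 0 r = K \<inter> cball 0 r"
    proof safe
      fix y assume y: "y \<in> span (insert b B)" "y \<in> cball 0 r"
      then obtain c where z: "y - c *\<^sub>R b \<in> span B" using span_breakdown_eq by metis
      define z where "z = y - c *\<^sub>R b"
      have yz: "y = c *\<^sub>R b + z" by (simp add: z_def)
      have "\<bar>c\<bar> * d \<le> r" using coeff[OF z, of c] y(2) by simp
      then have c: "\<bar>c\<bar> \<le> r / d" using d by (simp add: d_def field_simps)
      have "norm z \<le> norm y + \<bar>c\<bar> * norm b"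
        unfolding z_def using norm_triangle_ineq4[of y "c *\<^sub>R b"] by simp
      also have "\<dots> \<le> r + r / d * norm b" using y c by (intro add_mono mult_right_mono) auto
      finally show "y \<in> K" using z c unfolding K_def
        by (intro image_eqI[of _ _ "(c, z)"]) (auto simp: yz z_def[symmetric] abs_le_iff)
    next
      fix y assume "y \<in> K"
      then obtain c z where "y = c *\<^sub>R b + z" "z \<in> span B" by (auto simp: K_def)
      then show "y \<in> span (insert b B)"
        by (simp add: span_breakdown_eq) (metis add_diff_cancel_left')
    qed
    ultimately show ?thesis by (simp add: compact_Int_closed)
  qed
qed

text \<open>The common bound makes the seminorms equi-Lipschitz, so pointwise convergence to zero on
  a finite net of the compact unit ball is uniform there; homogeneity extends it to the
  span.\<close>

lemma seminorms_uniformly_null_on_span: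
  fixes B :: "'a::real_normed_vector set" and \<sigma> :: "nat \<Rightarrow> 'a \<Rightarrow> real"
  assumes "finite B" and "\<epsilon> > 0"
    and triangle: "\<And>n x y. \<sigma> n (x + y) \<le> \<sigma> n x + \<sigma> n y"
    and homogeneous: "\<And>n a x. \<sigma> n (a *\<^sub>R x) = \<bar>a\<bar> * \<sigma> n x"
    and bound: "\<And>n x. \<sigma> n x \<le> C * norm x"
    and null: "\<And>x. (\<lambda>n. \<sigma> n x) \<longlonglongrightarrow> 0"
  shows "\<forall>\<^sub>F n in sequentially. \<forall>y\<in>span B. \<sigma> n y \<le> \<epsilon> * norm y"
proof -
  define r where "r = \<epsilon> / 2 / (\<bar>C\<bar> + 1)"
  have r: "r > 0" "\<bar>C\<bar> * r \<le> \<epsilon> / 2" using \<open>\<epsilon> > 0\<close>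
    by (auto simp: r_def field_simps add_pos_nonneg intro!: mult_nonneg_nonneg)
  obtain k where k: "finite k" "span B \<inter> cball 0 1 \<subseteq> (\<Union>x\<in>k. ball x r)"
    using compact_span_Int_cball[OF \<open>finite B\<close>, of 1] r(1)
    unfolding compact_eq_totally_bounded by blast
  have "\<forall>\<^sub>F n in sequentially. \<sigma> n x < \<epsilon> / 2" for x
    using order_tendstoD(2)[OF null, of "\<epsilon> / 2"] \<open>\<epsilon> > 0\<close> by simp
  then have "\<forall>\<^sub>F n in sequentially. \<forall>x\<in>k. \<sigma> n x < \<epsilon> / 2"
    using k(1) by (simp add: eventually_ball_finite)
  then show ?thesis
  proof eventually_elim
    case (elim n)
    show ?case
    proof
      fix y assume y: "y \<in> span B"
      show "\<sigma> n y \<le> \<epsilon> * norm y"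
      proof (cases "y = 0")
        case True
        then show ?thesis using bound[of n 0] by simp
      next
        case False
        define v where "v = y /\<^sub>R norm y"
        have "v \<in> span B \<inter> cball 0 1" using y False by (simp add: v_def span_scale)
        then obtain x where x: "x \<in> k" "dist x v < r" using k(2) by auto
        have "\<sigma> n v \<le> \<sigma> n x + \<sigma> n (v - x)" using triangle[of n x "v - x"] by simp
        also have "\<sigma> n (v - x) \<le> \<bar>C\<bar> * norm (v - x)"
          using bound[of n "v - x"] by (smt (verit) mult_right_mono norm_ge_zero)
        also have "\<dots> \<le> \<bar>C\<bar> * r"
          using x(2) by (intro mult_left_mono) (auto simp: dist_norm norm_minus_commute)
        finally have "\<sigma> n v \<le> \<epsilon>" using r(2) elim x(1) by fastforce
        moreover have "\<sigma> n y = norm y * \<sigma> n v"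
          using homogeneous[of n "norm y" v] False by (simp add: v_def)
        ultimately show ?thesis by (simp add: mult.commute[of _ "norm y"] mult_left_mono)
      qed
    qed
  qed
qed

section \<open>Second differences of norms\<close>

text \<open>For a norm this amounts to two-sided differentiability along \<open>h\<close>, but no
  derivative is named, so the quotient can be estimated from layer to layer and carried to a
  limit.\<close>

definition smooth_along :: "('a::real_vector \<Rightarrow> real) \<Rightarrow> 'a \<Rightarrow> 'a \<Rightarrow> bool" where
  "smooth_along N x h \<longleftrightarrow>
     ((\<lambda>s. (N (x + s *\<^sub>R h) + N (x - s *\<^sub>R h) - 2 * N x) / s) \<longlongrightarrow> 0) (at 0)"

lemma is_normD:
  assumes "is_norm N"
  shows "N x = 0 \<longleftrightarrow> x = 0" "N (x + y) \<le> N x + N y" "N (a *\<^sub>R x) = \<bar>a\<bar> * N x"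
  using assms by (auto simp: is_norm_def)

lemma is_norm_minus: "N (- x) = N x" if "is_norm N"
  using is_normD(3)[OF that, of "-1" x] by simp

lemma is_norm_nonneg: "N x \<ge> 0" if "is_norm N"
  using is_normD(2)[OF that, of x "- x"] is_norm_minus[OF that] is_normD(1)[OF that, of 0] by simp

lemma is_norm_diff_le: "\<bar>N x - N y\<bar> \<le> N (x - y)" if "is_norm N"
  using is_normD(2)[OF that, of "x - y" y] is_normD(2)[OF that, of "y - x" x]
    is_norm_minus[OF that, of "x - y"] by simp

lemma gateaux_differentiable_imp_smooth_along:
  assumes "gateaux_differentiable N x"
  shows "smooth_along N x h"
proof -
  obtain L where L: "bounded_linear L"
      "\<And>h. ((\<lambda>t. (N (x + t *\<^sub>R h) - N x) /\<^sub>R t) \<longlongrightarrow> L h) (at 0)"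
    using assms by (auto simp: gateaux_differentiable_def)
  have "((\<lambda>t. (N (x + t *\<^sub>R h) - N x) /\<^sub>R t + (N (x + t *\<^sub>R (- h)) - N x) /\<^sub>R t)
      \<longlongrightarrow> L h + L (- h)) (at 0)"
    by (intro tendsto_add L)
  then show ?thesis
    unfolding smooth_along_def
    by (simp add: linear_neg[OF bounded_linear.linear[OF L(1)]] add_divide_distrib[symmetric]
        divide_inverse_commute[symmetric] field_simps)
qed

text \<open>Convexity: \<open>x + s *\<^sub>R h\<close> lies on the segment from \<open>x\<close> to
  \<open>x + t *\<^sub>R h\<close>.\<close>

lemma is_norm_quotient_mono:
  assumes N: "is_norm N" and "0 < s" "s \<le> t"
  shows "(N (x + s *\<^sub>R h) - N x) / s \<le> (N (x + t *\<^sub>R h) - N x) / t"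
proof -
  have "x + s *\<^sub>R h = (s / t) *\<^sub>R (x + t *\<^sub>R h) + (1 - s / t) *\<^sub>R x"
    using assms by (simp add: algebra_simps)
  then have "N (x + s *\<^sub>R h) \<le> N ((s / t) *\<^sub>R (x + t *\<^sub>R h)) + N ((1 - s / t) *\<^sub>R x)"
    using is_normD(2)[OF N] by metis
  also have "\<dots> = s / t * N (x + t *\<^sub>R h) + (1 - s / t) * N x"
    using assms by (simp add: is_normD(3)[OF N])
  finally show ?thesis using assms by (simp add: field_simps)
qed

text \<open>Monotone quotients give right derivatives along \<open>h\<close> and \<open>- h\<close>
  as infima. The vanishing second difference makes them sum to zero, so the left and right
  derivatives along \<open>h\<close> agree.\<close>

lemma smooth_along_imp_directional_derivative:
  assumes N: "is_norm N" and smooth: "smooth_along N x h"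
  shows "\<exists>l. ((\<lambda>t. (N (x + t *\<^sub>R h) - N x) / t) \<longlongrightarrow> l) (at 0)"
proof -
  define q where "q h t = (N (x + t *\<^sub>R h) - N x) / t" for h t
  have bdd: "- N h \<le> q h t" if "t > 0" for h t
    using is_norm_diff_le[OF N, of "x + t *\<^sub>R h" x] that
    by (simp add: q_def is_normD(3)[OF N] field_simps abs_le_iff)
  have right: "(q h \<longlongrightarrow> Inf (q h ` {0<..})) (at_right 0)" for h
  proof (rule order_tendstoI)
    fix a assume "a < Inf (q h ` {0<..})"
    moreover have "Inf (q h ` {0<..}) \<le> q h t" if "t > 0" for t
      using that bdd by (intro cInf_lower) (auto intro!: bdd_belowI2[of _ "- N h"])
    ultimately show "\<forall>\<^sub>F t in at_right 0. a < q h t"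
      by (auto simp: eventually_at_right_less eventually_at_right_field intro!: exI[of _ 1]
          elim: less_le_trans)
  next
    fix a assume "Inf (q h ` {0<..}) < a"
    then obtain t where t: "t > 0" "q h t < a"
      by (subst (asm) cInf_less_iff) (auto intro!: bdd_belowI2[of _ "- N h"] bdd)
    then show "\<forall>\<^sub>F s in at_right 0. q h s < a"
      using is_norm_quotient_mono[OF N, of _ t x h]
      by (auto simp: eventually_at_right_field q_def intro!: exI[of _ t] elim!: le_less_trans[rotated])
  qed
  define p where "p h = Inf (q h ` {0<..})" for h
  have "((\<lambda>t. q h t + q (- h) t) \<longlongrightarrow> p h + p (- h)) (at_right 0)"
    unfolding p_def by (intro tendsto_add right)
  moreover have "((\<lambda>t. q h t + q (- h) t) \<longlongrightarrow> 0) (at_right 0)"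
    using smooth filterlim_at_split unfolding smooth_along_def q_def
    by (auto simp: add_divide_distrib[symmetric] algebra_simps filterlim_at_split)
  ultimately have p: "p h = - p (- h)"
    using tendsto_unique[OF trivial_limit_at_right_real] by fastforce
  have "((\<lambda>t. - q (- h) t) \<longlongrightarrow> - p (- h)) (at_right 0)"
    unfolding p_def by (intro tendsto_minus right)
  then have "(q h \<longlongrightarrow> - p (- h)) (at_left 0)"
    unfolding filterlim_at_left_to_right by (simp add: q_def)
  then have "(q h \<longlongrightarrow> p h) (at 0)"
    using right[of h] p by (simp add: filterlim_at_split p_def)
  then show ?thesis unfolding q_def by blast
qed

text \<open>The directional derivative is homogeneous by rescaling \<open>t\<close>, subadditive by
  convexity and dominated by \<open>N\<close>; being odd as well, it is additive and
  bounded.\<close>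

lemma smooth_along_imp_gateaux_differentiable:
  fixes N :: "'a::real_normed_vector \<Rightarrow> real"
  assumes N: "is_norm N" and bound: "\<And>h. N h \<le> C * norm h"
    and smooth: "\<And>h. smooth_along N x h"
  shows "gateaux_differentiable N x"
proof -
  define q where "q h t = (N (x + t *\<^sub>R h) - N x) / t" for h t
  obtain L where L: "(q h \<longlongrightarrow> L h) (at 0)" for h
    using smooth_along_imp_directional_derivative[OF N smooth] unfolding q_def by metis
  have scaled: "((\<lambda>t. q h (c * t)) \<longlongrightarrow> L h) (at 0)" if "c \<noteq> 0" for c h
    using L[of h] by (rule filterlim_compose) (use that in \<open>auto simp: filterlim_at
        intro!: tendsto_eq_intros eventually_at_filter[THEN iffD2]\<close>)
  have scale: "L (c *\<^sub>R h) = c * L h" for c h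
  proof (cases "c = 0")
    case True
    have "q 0 = (\<lambda>_. 0)" by (simp add: q_def fun_eq_iff)
    then show ?thesis using LIM_unique[OF L[of 0], of 0] True by simp
  next
    case False
    have "q (c *\<^sub>R h) = (\<lambda>t. c * q h (c * t))"
      using False by (simp add: q_def fun_eq_iff mult.commute)
    then have "(q (c *\<^sub>R h) \<longlongrightarrow> c * L h) (at 0)"
      using tendsto_mult_left[OF scaled[OF False]] by metis
    then show ?thesis using L LIM_unique by blast
  qed
  have sub: "L (h + g) \<le> L h + L g" for h g
  proof -
    \<comment> \<open>The step is doubled because \<open>x + t *\<^sub>R (h + g)\<close> is the
      midpoint of the points reached along \<open>h\<close> and \<open>g\<close> with step
      \<open>2 * t\<close>.\<close>
    have "q (h + g) t \<le> q h (2 * t) + q g (2 * t)" if "t > 0" for t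
    proof -
      have "x + t *\<^sub>R (h + g) = (1/2) *\<^sub>R ((x + (2 * t) *\<^sub>R h) + (x + (2 * t) *\<^sub>R g))"
        by (simp add: algebra_simps scaleR_2[symmetric])
      then have "N (x + t *\<^sub>R (h + g)) \<le> 1/2 * (N (x + (2 * t) *\<^sub>R h) + N (x + (2 * t) *\<^sub>R g))"
        using is_normD(2,3)[OF N] by (metis abs_divide abs_numeral abs_one mult_left_mono
            zero_le_divide_1_iff zero_le_numeral)
      then have "(N (x + t *\<^sub>R (h + g)) - N x) / t
          \<le> ((N (x + (2 * t) *\<^sub>R h) - N x + (N (x + (2 * t) *\<^sub>R g) - N x)) / 2) / t"
        using that by (intro divide_right_mono) auto
      then show ?thesis by (simp add: q_def add_divide_distrib[symmetric])
    qed
    moreover have "((\<lambda>t. q h (2 * t) + q g (2 * t)) \<longlongrightarrow> L h + L g) (at_right 0)"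
      using scaled[of 2 h] scaled[of 2 g] by (auto simp: filterlim_at_split intro!: tendsto_add)
    moreover have "(q (h + g) \<longlongrightarrow> L (h + g)) (at_right 0)"
      using L filterlim_at_split by blast
    ultimately show ?thesis
      by (intro tendsto_le[OF trivial_limit_at_right_real])
        (auto simp: eventually_at_right_field intro!: exI[of _ 1])
  qed
  have minus: "L (- h) = - L h" for h using scale[of "-1" h] by simp
  have le: "L h \<le> N h" for h
  proof -
    have "q h t \<le> N h" if "t > 0" for t
      using is_normD(2)[OF N, of x "t *\<^sub>R h"] that by (simp add: q_def is_normD(3)[OF N] field_simps)
    then have "\<forall>\<^sub>F t in at_right 0. q h t \<le> N h"
      by (auto simp: eventually_at_right_field intro!: exI[of _ 1])
    then show ?thesis
      using L filterlim_at_split tendsto_upperbound trivial_limit_at_right_real by metis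
  qed
  have "bounded_linear L"
  proof
    show "L (h + g) = L h + L g" for h g
      using sub[of h g] sub[of "- h" "- g"] minus[of "h + g"] by (simp add: minus)
    show "L (c *\<^sub>R h) = c *\<^sub>R L h" for c h by (simp add: scale)
    have "\<bar>L h\<bar> \<le> norm h * C" for h
      using le[of h] le[of "- h"] bound[of h] minus is_norm_minus[OF N]
      by (simp add: abs_le_iff mult.commute)
    then show "\<exists>K. \<forall>h. norm (L h) \<le> norm h * K" by auto
  qed
  then show ?thesis
    using L unfolding gateaux_differentiable_def q_def
    by (auto simp: divide_inverse_commute intro!: exI[of _ L])
qed

section \<open>The layered norm\<close>

text \<open>On the half-plane \<^term>\<open>a \<ge> 0\<close>, a norm in \<^term>\<open>(a, t)\<close> that is close to \<^term>\<open>\<bar>a\<bar> + \<bar>t\<bar>\<close> for small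
  \<^term>\<open>\<delta>\<close>, is smooth where \<^term>\<open>a > 0\<close>, and gives \<^term>\<open>a\<close> at \<^term>\<open>t = 0\<close>.\<close>

definition layer :: "real \<Rightarrow> real \<Rightarrow> real \<Rightarrow> real" where
  "layer \<delta> a t = (1 - \<delta>) * a + sqrt (t\<^sup>2 + (\<delta> * a)\<^sup>2)"

lemma layer_upper: "layer \<delta> a t \<le> a + \<bar>t\<bar>" if "0 \<le> a" "0 \<le> \<delta>"
  using sqrt_sum_squares_le_sum_abs[of t "\<delta> * a"] that
  by (simp add: layer_def left_diff_distrib)

lemma layer_lower: "(1 - \<delta>) * a + \<bar>t\<bar> \<le> layer \<delta> a t"
  by (simp add: layer_def real_le_rsqrt)

lemma layer_increases: "a \<le> layer \<delta> a t"
proof -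
  have "\<delta> * a \<le> sqrt (t\<^sup>2 + (\<delta> * a)\<^sup>2)" by (simp add: real_le_rsqrt)
  then show ?thesis by (simp add: layer_def algebra_simps)
qed

lemma layer_zero [simp]: "layer \<delta> a 0 = a" if "0 \<le> a" "0 \<le> \<delta>"
  using that by (simp add: layer_def left_diff_distrib)

lemma layer_mult: "layer \<delta> (\<bar>c\<bar> * a) (c * t) = \<bar>c\<bar> * layer \<delta> a t"
proof -
  have "(c * t)\<^sup>2 + (\<delta> * (\<bar>c\<bar> * a))\<^sup>2 = c\<^sup>2 * (t\<^sup>2 + (\<delta> * a)\<^sup>2)"
    by (simp add: power_mult_distrib algebra_simps)
  then show ?thesis unfolding layer_def by (simp only: real_sqrt_mult real_sqrt_abs) (simp add: algebra_simps)
qed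

lemma layer_mono:
  assumes "0 \<le> \<delta>" "\<delta> \<le> 1" "0 \<le> a" "a \<le> b"
  shows "layer \<delta> a t \<le> layer \<delta> b t"
proof -
  have "(\<delta> * a)\<^sup>2 \<le> (\<delta> * b)\<^sup>2" using assms by (intro power_mono mult_left_mono) auto
  then show ?thesis unfolding layer_def using assms by (intro add_mono mult_left_mono) auto
qed

lemma layer_triangle: "layer \<delta> (a + b) (t + u) \<le> layer \<delta> a t + layer \<delta> b u"
  using real_sqrt_sum_squares_triangle_ineq[of t u "\<delta> * a" "\<delta> * b"]
  by (simp add: layer_def algebra_simps)

lemma layer_Lipschitz: "layer \<delta> a (t + u) \<le> layer \<delta> a t + \<bar>u\<bar>"
  using real_sqrt_sum_squares_triangle_ineq[of t u "\<delta> * a" 0] by (simp add: layer_def)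

text \<open>The square root contributes \<open>\<delta>\<close> times the second difference of the
  first argument and the linear term contributes \<open>1 - \<delta>\<close> times it. The total
  coefficient is 1, so errors add over the layers without being amplified.\<close>

lemma layer_second_difference:
  assumes \<delta>: "0 < \<delta>" and a: "0 < a" and k: "\<bar>p - a\<bar> \<le> k" "\<bar>m - a\<bar> \<le> k" and d: "0 \<le> p + m - 2 * a"
  shows "layer \<delta> p (t + u) + layer \<delta> m (t - u) - 2 * layer \<delta> a t
      \<le> (p + m - 2 * a) + (u\<^sup>2 / \<delta> + \<delta> * k\<^sup>2) / a"
proof -
  define q where "q = sqrt (t\<^sup>2 + (\<delta> * a)\<^sup>2)"
  define q1 where "q1 = sqrt ((t + u)\<^sup>2 + (\<delta> * p)\<^sup>2)"
  define q2 where "q2 = sqrt ((t - u)\<^sup>2 + (\<delta> * m)\<^sup>2)"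
  define d where "d = p + m - 2 * a"
  have q: "\<delta> * a \<le> q" "0 < \<delta> * a" using \<delta> a by (auto simp: q_def real_le_rsqrt)
  have sq: "q\<^sup>2 = t\<^sup>2 + (\<delta> * a)\<^sup>2" "q1\<^sup>2 = (t + u)\<^sup>2 + (\<delta> * p)\<^sup>2" "q2\<^sup>2 = (t - u)\<^sup>2 + (\<delta> * m)\<^sup>2"
    by (simp_all add: q_def q1_def q2_def)
  have "(p - a)\<^sup>2 \<le> k\<^sup>2" "(m - a)\<^sup>2 \<le> k\<^sup>2" using k by (auto simp: abs_le_square_iff[symmetric])
  then have "\<delta>\<^sup>2 * ((p - a)\<^sup>2 + (m - a)\<^sup>2) \<le> \<delta>\<^sup>2 * (2 * k\<^sup>2)" by (intro mult_left_mono) auto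
  moreover have "q1\<^sup>2 + q2\<^sup>2 - 2 * q\<^sup>2
      = 2 * u\<^sup>2 + 2 * \<delta>\<^sup>2 * a * d + \<delta>\<^sup>2 * ((p - a)\<^sup>2 + (m - a)\<^sup>2)"
    unfolding sq d_def by (simp add: power2_eq_square algebra_simps)
  \<comment> \<open>This is the nonnegativity of the sum of the squares of \<open>q1 - q\<close> and
    \<open>q2 - q\<close>.\<close>
  moreover have "2 * q * (q1 + q2 - 2 * q) \<le> q1\<^sup>2 + q2\<^sup>2 - 2 * q\<^sup>2"
    using zero_le_power2[of "q1 - q"] zero_le_power2[of "q2 - q"]
    by (simp add: power2_eq_square algebra_simps)
  ultimately have "q * (q1 + q2 - 2 * q) \<le> u\<^sup>2 + \<delta>\<^sup>2 * a * d + \<delta>\<^sup>2 * k\<^sup>2" by simp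
  then have "q1 + q2 - 2 * q \<le> (u\<^sup>2 + \<delta>\<^sup>2 * a * d + \<delta>\<^sup>2 * k\<^sup>2) / q"
    using q by (simp add: pos_le_divide_eq mult.commute)
  also have "\<dots> \<le> (u\<^sup>2 + \<delta>\<^sup>2 * a * d + \<delta>\<^sup>2 * k\<^sup>2) / (\<delta> * a)"
    using q a d by (intro divide_left_mono) (auto simp: d_def)
  also have "\<dots> = \<delta> * d + (u\<^sup>2 / \<delta> + \<delta> * k\<^sup>2) / a"
    using \<delta> a by (simp add: field_simps power2_eq_square)
  finally show ?thesis
    unfolding layer_def q_def[symmetric] q1_def[symmetric] q2_def[symmetric]
    by (simp add: d_def algebra_simps)
qed

locale layered_norm =
  fixes N\<^sub>0 :: "'a::real_normed_vector \<Rightarrow> real" and f :: "nat \<Rightarrow> 'a \<Rightarrow> real"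
  assumes base: "is_norm N\<^sub>0"
    and linear_f: "linear (f n)"
    and summable_f: "summable (\<lambda>n. \<bar>f n x\<bar>)"
begin

section \<open>The approximating norms\<close>

primrec partial :: "nat \<Rightarrow> 'a \<Rightarrow> real" where
  "partial 0 x = N\<^sub>0 x"
| "partial (Suc n) x = layer ((1/2) ^ Suc n) (partial n x) (f n x)"

definition limit :: "'a \<Rightarrow> real" where
  "limit x = lim (\<lambda>n. partial n x)"

definition tail :: "nat \<Rightarrow> 'a \<Rightarrow> real" where
  "tail n x = (\<Sum>j. \<bar>f (j + n) x\<bar>)"

lemmas f_simps [simp] =
  linear_add[OF linear_f] linear_diff[OF linear_f] linear_cmul[OF linear_f] linear_neg[OF linear_f]
  linear_0[OF linear_f]

lemma weight: "0 < (1/2::real) ^ Suc n" "0 \<le> (1/2::real) ^ Suc n" "(1/2::real) ^ Suc n \<le> 1"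
  using power_le_one[of "1/2::real" "Suc n"] by (auto simp del: power_Suc)

lemma partial_nonneg: "0 \<le> partial n x"
proof (induction n)
  case 0
  show ?case using is_norm_nonneg[OF base] by simp
next
  case (Suc n)
  then show ?case using layer_increases[of "partial n x"] order_trans unfolding partial.simps by blast
qed

lemma incseq_partial: "incseq (\<lambda>n. partial n x)"
  using layer_increases by (intro incseq_SucI) simp

lemma partial_mono: "i \<le> j \<Longrightarrow> partial i x \<le> partial j x"
  using incseq_partial by (simp add: incseq_def)

text \<open>Subadditivity passes to the next layer because \<open>layer\<close> is monotone in its
  first argument and subadditive in the pair.\<close>

lemma is_norm_partial: "is_norm (partial n)"
proof (induction n)
  case 0
  then show ?case using base by (simp add: is_norm_def)
next
  case (Suc n)
  show ?case
    unfolding is_norm_def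
  proof (intro conjI allI)
    fix x y c
    show "partial (Suc n) x = 0 \<longleftrightarrow> x = 0"
      using is_normD(1)[OF Suc] partial_nonneg[of n] weight(2)
        layer_increases[of "partial n x" "(1/2) ^ Suc n" "f n x"]
      by (metis f_simps(5) layer_zero order_antisym partial.simps(2))
    have "partial (Suc n) (x + y) \<le> layer ((1/2) ^ Suc n) (partial n x + partial n y) (f n x + f n y)"
      using layer_mono[OF weight(2,3) partial_nonneg is_normD(2)[OF Suc]] by (simp del: power_Suc)
    also have "\<dots> \<le> partial (Suc n) x + partial (Suc n) y"
      unfolding partial.simps by (rule layer_triangle)
    finally show "partial (Suc n) (x + y) \<le> partial (Suc n) x + partial (Suc n) y" .
    show "partial (Suc n) (c *\<^sub>R x) = \<bar>c\<bar> * partial (Suc n) x"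
      using layer_mult by (simp add: is_normD(3)[OF Suc] del: power_Suc)
  qed
qed

section \<open>Tails of the coordinate series\<close>

lemma summable_shift: "summable (\<lambda>j. \<bar>f (j + n) x\<bar>)"
  using summable_f by (simp add: summable_iff_shift[of "\<lambda>j. \<bar>f j x\<bar>"])

lemma tail_Suc: "tail n x = \<bar>f n x\<bar> + tail (Suc n) x"
  using suminf_split_head[OF summable_shift[of n x]] by (simp add: tail_def)

lemma tail_nonneg: "0 \<le> tail n x"
  by (simp add: tail_def suminf_nonneg summable_shift)

lemma abs_f_le_tail: "\<bar>f n x\<bar> \<le> tail n x"
  using tail_Suc[of n x] tail_nonneg[of "Suc n" x] by simp

lemma tail_le: "tail n x \<le> tail 0 x"
proof (induction n)
  case (Suc n)
  then show ?case using tail_Suc[of n x] by simp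
qed simp

lemma tail_add: "tail n (x + y) \<le> tail n x + tail n y"
  unfolding tail_def
  by (subst suminf_add) (auto intro!: suminf_le summable_add summable_shift abs_triangle_ineq
      summable_shift[of _ "x + y", simplified])

lemma tail_scaleR: "tail n (c *\<^sub>R x) = \<bar>c\<bar> * tail n x"
  unfolding tail_def by (simp add: abs_mult suminf_mult summable_shift)

lemma tail_tendsto_0: "(\<lambda>n. tail n x) \<longlonglongrightarrow> 0"
proof -
  have eq: "(\<lambda>n. tail n x) = (\<lambda>n. tail 0 x - (\<Sum>j<n. \<bar>f j x\<bar>))"
    using suminf_minus_initial_segment[OF summable_f, of _ x] by (simp add: tail_def fun_eq_iff)
  have "(\<lambda>n. \<Sum>j<n. \<bar>f j x\<bar>) \<longlonglongrightarrow> tail 0 x"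
    using summable_LIMSEQ[OF summable_f, of x] by (simp add: tail_def)
  then have "(\<lambda>n. tail 0 x - (\<Sum>j<n. \<bar>f j x\<bar>)) \<longlonglongrightarrow> tail 0 x - tail 0 x"
    by (rule tendsto_diff[OF tendsto_const])
  then show ?thesis by (subst eq) simp
qed

text \<open>A layer adds at most the absolute value of its coordinate, which is exactly what the
  tail loses.\<close>

lemma partial_plus_tail_antimono: "i \<le> j \<Longrightarrow> partial j x + tail j x \<le> partial i x + tail i x"
proof (induction j rule: dec_induct)
  case (step j)
  then show ?case
    using layer_upper[OF partial_nonneg[of j x] weight(2)[of j], of "f j x"] tail_Suc[of j x]
    by (simp del: power_Suc)
qed simp

section \<open>The limit norm and its lower bound\<close>

lemma partial_tendsto_limit: "(\<lambda>n. partial n x) \<longlonglongrightarrow> limit x"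
proof -
  have "partial n x \<le> partial 0 x + tail 0 x" for n
    using partial_plus_tail_antimono[of 0 n x] tail_nonneg[of n x] by simp
  then have "convergent (\<lambda>n. partial n x)"
    using incseq_convergent[OF incseq_partial] unfolding convergent_def by metis
  then show ?thesis by (simp add: limit_def convergent_LIMSEQ_iff)
qed

lemma partial_le_limit: "partial n x \<le> limit x"
  using incseq_le[OF incseq_partial partial_tendsto_limit] .

lemma limit_le: "limit x \<le> partial n x + tail n x"
proof -
  have "limit x + 0 \<le> partial n x + tail n x"
    using partial_plus_tail_antimono[of n]
    by (intro LIMSEQ_le_const2[OF tendsto_add[OF partial_tendsto_limit tail_tendsto_0]]) auto
  then show ?thesis by simp
qed

lemma is_norm_limit: "is_norm limit"
  unfolding is_norm_def
proof (intro conjI allI)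
  fix x y c
  have "limit 0 = 0"
    using partial_tendsto_limit[of 0] is_normD(1)[OF is_norm_partial, of _ 0]
    by (simp add: LIMSEQ_const_iff)
  moreover have "x = 0" if "limit x = 0"
    using partial_le_limit[of 0 x] is_normD(1)[OF base, of x] is_norm_nonneg[OF base, of x] that by simp
  ultimately show "limit x = 0 \<longleftrightarrow> x = 0" by blast
  show "limit (x + y) \<le> limit x + limit y"
    by (intro LIMSEQ_le[OF partial_tendsto_limit tendsto_add[OF partial_tendsto_limit partial_tendsto_limit]])
      (auto intro: is_normD(2)[OF is_norm_partial])
  show "limit (c *\<^sub>R x) = \<bar>c\<bar> * limit x"
    using partial_tendsto_limit[of "c *\<^sub>R x"] tendsto_mult_left[OF partial_tendsto_limit, of "\<bar>c\<bar>" x]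
    by (simp add: is_normD(3)[OF is_norm_partial] LIMSEQ_unique)
qed

text \<open>Layer \<open>n\<close> gains at least \<open>\<bar>f n x\<bar>\<close> minus its weight
  times \<open>limit x\<close>. The weights sum to 1, so the total loss is at most one further copy
  of \<open>limit x\<close>.\<close>

lemma limit_lower: "N\<^sub>0 x + tail 0 x \<le> 2 * limit x"
proof -
  \<comment> \<open>The factor \<open>1 - (1/2) ^ n\<close> is the sum of the first \<open>n\<close>
    weights.\<close>
  have "N\<^sub>0 x + tail 0 x \<le> partial n x + tail n x + (1 - (1/2) ^ n) * limit x" for n
  proof (induction n)
    case (Suc n)
    define \<delta> :: real where "\<delta> = (1/2) ^ Suc n"
    have "\<delta> * partial n x \<le> \<delta> * limit x"
      unfolding \<delta>_def using partial_le_limit by (intro mult_left_mono) auto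
    moreover have "(1/2) ^ n = 2 * \<delta>" by (simp add: \<delta>_def)
    ultimately show ?case
      using Suc layer_lower[of \<delta> "partial n x" "f n x"] tail_Suc[of n x]
      unfolding partial.simps \<delta>_def[symmetric] by (simp add: algebra_simps)
  qed simp
  moreover have "(\<lambda>n. partial n x + tail n x + (1 - (1/2) ^ n) * limit x)
      \<longlonglongrightarrow> limit x + 0 + (1 - 0) * limit x"
    by (intro tendsto_intros partial_tendsto_limit tail_tendsto_0) auto
  ultimately show ?thesis
    using LIMSEQ_le_const by fastforce
qed

section \<open>Second differences through the layers and in the limit\<close>

lemma partial_second_difference_nonneg:
  "0 \<le> partial n (x + s *\<^sub>R h) + partial n (x - s *\<^sub>R h) - 2 * partial n x"
  using is_normD(2)[OF is_norm_partial, of n "x + s *\<^sub>R h" "x - s *\<^sub>R h"]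
    is_normD(3)[OF is_norm_partial, of n 2 x]
  by (simp add: scaleR_2)

text \<open>Passing from \<open>partial n h\<close> to \<open>limit h\<close> makes the bound
  uniform in \<open>n\<close>.\<close>

lemma partial_diff_le: "\<bar>partial n (x + s *\<^sub>R h) - partial n x\<bar> \<le> \<bar>s\<bar> * limit h"
proof -
  have "\<bar>partial n (x + s *\<^sub>R h) - partial n x\<bar> \<le> \<bar>s\<bar> * partial n h"
    using is_norm_diff_le[OF is_norm_partial, of n "x + s *\<^sub>R h" x]
    by (simp add: is_normD(3)[OF is_norm_partial])
  also have "\<dots> \<le> \<bar>s\<bar> * limit h" by (intro mult_left_mono partial_le_limit) auto
  finally show ?thesis .
qed

text \<open>The first bound is of order \<^term>\<open>s\<^sup>2\<close> but its constants are not summable over \<^term>\<open>n\<close>, so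
  it serves for finitely many layers only; the second one controls the remaining layers by a tail of
  the coordinate series.\<close>

lemma partial_second_difference_step:
  fixes n x h s
  assumes "x \<noteq> 0"
  defines "D m \<equiv> partial m (x + s *\<^sub>R h) + partial m (x - s *\<^sub>R h) - 2 * partial m x"
  shows "D (Suc n) \<le> D n + ((s * f n h)\<^sup>2 / (1/2) ^ Suc n + (1/2) ^ Suc n * (\<bar>s\<bar> * limit h)\<^sup>2) / N\<^sub>0 x"
    and "D (Suc n) \<le> D n + 2 * \<bar>s * f n h\<bar> + (1/2) ^ Suc n * (\<bar>s\<bar> * limit h)\<^sup>2 / N\<^sub>0 x"
proof -
  define \<delta> :: real where "\<delta> = (1/2) ^ Suc n"
  define a where "a = partial n x"
  define p where "p = partial n (x + s *\<^sub>R h)"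
  define m where "m = partial n (x - s *\<^sub>R h)"
  have N: "0 < N\<^sub>0 x" "N\<^sub>0 x \<le> a"
    using is_normD(1)[OF base, of x] is_norm_nonneg[OF base, of x] assms(1) partial_mono[of 0 n x]
    by (auto simp: a_def)
  have k: "\<bar>p - a\<bar> \<le> \<bar>s\<bar> * limit h" "\<bar>m - a\<bar> \<le> \<bar>s\<bar> * limit h"
    using partial_diff_le[of n x s h] partial_diff_le[of n x "- s" h] by (auto simp: p_def m_def a_def)
  have d: "0 \<le> p + m - 2 * a" and \<delta>: "0 < \<delta>"
    using partial_second_difference_nonneg by (auto simp: p_def m_def a_def \<delta>_def)
  have D: "D n = p + m - 2 * a"
      "D (Suc n) = layer \<delta> p (f n x + s * f n h) + layer \<delta> m (f n x - s * f n h) - 2 * layer \<delta> a (f n x)"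
    by (simp_all add: D_def p_def m_def a_def \<delta>_def)
  \<comment> \<open>Since \<open>N\<^sub>0 x\<close> bounds every \<open>partial n x\<close> from
    below, the denominator becomes independent of \<open>n\<close>.\<close>
  have weaken: "c / a \<le> c / N\<^sub>0 x" if "0 \<le> c" for c
    using that N by (intro divide_left_mono) auto
  have step: "layer \<delta> p (t + u) + layer \<delta> m (t - u) - 2 * layer \<delta> a t
      \<le> (p + m - 2 * a) + (u\<^sup>2 / \<delta> + \<delta> * (\<bar>s\<bar> * limit h)\<^sup>2) / N\<^sub>0 x" for t u
    using layer_second_difference[OF \<delta> _ k d, of t u] N \<delta>
      weaken[of "u\<^sup>2 / \<delta> + \<delta> * (\<bar>s\<bar> * limit h)\<^sup>2"] by fastforce
  show "D (Suc n) \<le> D n + ((s * f n h)\<^sup>2 / (1/2) ^ Suc n + (1/2) ^ Suc n * (\<bar>s\<bar> * limit h)\<^sup>2) / N\<^sub>0 x"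
    using step[of "f n x" "s * f n h"] unfolding D \<delta>_def .
  \<comment> \<open>Here the coordinate is frozen at \<open>f n x\<close>; the Lipschitz estimate
    pays \<open>\<bar>s * f n h\<bar>\<close> for each of the two shifts.\<close>
  show "D (Suc n) \<le> D n + 2 * \<bar>s * f n h\<bar> + (1/2) ^ Suc n * (\<bar>s\<bar> * limit h)\<^sup>2 / N\<^sub>0 x"
    using step[of "f n x" 0] layer_Lipschitz[of \<delta> p "f n x" "s * f n h"]
      layer_Lipschitz[of \<delta> m "f n x" "- (s * f n h)"] unfolding D \<delta>_def[symmetric] by simp
qed

text \<open>One layer adds an error quadratic in \<open>s\<close>, which still vanishes after
  division by \<open>s\<close>.\<close>

lemma smooth_along_partial:
  assumes "smooth_along N\<^sub>0 x h" "x \<noteq> 0"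
  shows "smooth_along (partial n) x h"
proof (induction n)
  case 0
  then show ?case using assms by (simp add: smooth_along_def)
next
  case (Suc n)
  define C where "C = ((f n h)\<^sup>2 / (1/2) ^ Suc n + (1/2) ^ Suc n * (limit h)\<^sup>2) / N\<^sub>0 x"
  let ?D = "\<lambda>m s. partial m (x + s *\<^sub>R h) + partial m (x - s *\<^sub>R h) - 2 * partial m x"
  have "\<bar>?D (Suc n) s / s\<bar> \<le> \<bar>?D n s / s\<bar> + C * \<bar>s\<bar>" if "s \<noteq> 0" for s
  proof -
    have "?D (Suc n) s \<le> ?D n s + C * \<bar>s\<bar> * \<bar>s\<bar>"
      using partial_second_difference_step(1)[OF assms(2), of n s h]
      by (simp add: C_def power_mult_distrib algebra_simps add_divide_distrib power2_eq_square)
    then have "?D (Suc n) s / \<bar>s\<bar> \<le> (?D n s + C * \<bar>s\<bar> * \<bar>s\<bar>) / \<bar>s\<bar>"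
      by (intro divide_right_mono) auto
    then show ?thesis
      using that partial_second_difference_nonneg[of _ x s h]
      by (simp add: abs_divide add_divide_distrib del: partial.simps)
  qed
  then have "\<forall>\<^sub>F s in at 0. norm (?D (Suc n) s / s) \<le> \<bar>?D n s / s\<bar> + C * \<bar>s\<bar>"
    by (simp add: eventually_at_filter del: partial.simps)
  moreover have "((\<lambda>s. \<bar>?D n s / s\<bar> + C * \<bar>s\<bar>) \<longlongrightarrow> \<bar>0\<bar> + C * \<bar>0\<bar>) (at 0)"
    by (intro tendsto_intros Suc[unfolded smooth_along_def])
  then have "((\<lambda>s. \<bar>?D n s / s\<bar> + C * \<bar>s\<bar>) \<longlongrightarrow> 0) (at 0)" by simp
  ultimately show ?case
    unfolding smooth_along_def by (rule Lim_null_comparison)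
qed

text \<open>First fix \<open>n\<close> with a small tail at \<open>h\<close>, so that the layers
  from \<open>n\<close> on contribute little even after division by \<open>s\<close>; then let
  \<open>s\<close> tend to 0 in the smooth norm \<open>partial n\<close>.\<close>

lemma smooth_along_limit:
  assumes "smooth_along N\<^sub>0 x h" "x \<noteq> 0"
  shows "smooth_along limit x h"
proof -
  let ?D = "\<lambda>m s. partial m (x + s *\<^sub>R h) + partial m (x - s *\<^sub>R h) - 2 * partial m x"
  let ?L = "\<lambda>s. limit (x + s *\<^sub>R h) + limit (x - s *\<^sub>R h) - 2 * limit x"
  define C where "C = (limit h)\<^sup>2 / N\<^sub>0 x"
  have C: "0 \<le> C" using is_norm_nonneg[OF base] by (simp add: C_def)
  have lim: "(\<lambda>m. ?D m s) \<longlonglongrightarrow> ?L s" for s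
    by (intro tendsto_intros partial_tendsto_limit)
  have L: "0 \<le> ?L s" for s
    using partial_second_difference_nonneg by (intro LIMSEQ_le_const[OF lim]) blast
  \<comment> \<open>Both errors of the second step estimate are written as differences, so that they
    telescope over the layers from \<open>n\<close> to \<open>m\<close>.\<close>
  have partial: "?D m s \<le> ?D n s + 2 * \<bar>s\<bar> * (tail n h - tail m h) + C * s\<^sup>2 * ((1/2) ^ n - (1/2) ^ m)"
    if "n \<le> m" for n m s
    using that
  proof (induction m rule: dec_induct)
    case (step m)
    have "2 * \<bar>s * f m h\<bar> = 2 * \<bar>s\<bar> * (tail m h - tail (Suc m) h)"
      by (simp add: tail_Suc[of m] abs_mult)
    moreover have "(1/2) ^ Suc m * (\<bar>s\<bar> * limit h)\<^sup>2 / N\<^sub>0 x = C * s\<^sup>2 * ((1/2) ^ m - (1/2) ^ Suc m)"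
      by (simp add: C_def power_mult_distrib mult_ac)
    ultimately show ?case
      using partial_second_difference_step(2)[OF assms(2), of m s h] step.IH
      by (simp add: algebra_simps del: partial.simps)
  qed simp
  have le: "?L s \<le> ?D n s + 2 * \<bar>s\<bar> * tail n h + C * s\<^sup>2" for n s
  proof -
    have "?D m s \<le> ?D n s + 2 * \<bar>s\<bar> * tail n h + C * s\<^sup>2" if "n \<le> m" for m
    proof -
      have "2 * \<bar>s\<bar> * (tail n h - tail m h) \<le> 2 * \<bar>s\<bar> * tail n h"
        using tail_nonneg by (intro mult_left_mono) auto
      moreover have "(1/2::real) ^ n - (1/2) ^ m \<le> 1"
        using power_le_one[of "1/2::real" n] zero_le_power[of "1/2::real" m] by linarith
      then have "C * s\<^sup>2 * ((1/2) ^ n - (1/2) ^ m) \<le> C * s\<^sup>2 * 1"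
        using C by (intro mult_left_mono) auto
      ultimately show ?thesis using partial[OF that, of s] by linarith
    qed
    then show ?thesis by (intro LIMSEQ_le_const2[OF lim]) blast
  qed
  show ?thesis
    unfolding smooth_along_def
  proof (rule tendstoI)
    fix \<epsilon> :: real assume "0 < \<epsilon>"
    then have "\<forall>\<^sub>F n in sequentially. tail n h < \<epsilon> / 4"
      by (intro order_tendstoD(2)[OF tail_tendsto_0]) simp
    then obtain n where n: "tail n h < \<epsilon> / 4"
      using eventually_happens trivial_limit_sequentially by blast
    have "((\<lambda>s. \<bar>?D n s / s\<bar> + C * \<bar>s\<bar>) \<longlongrightarrow> \<bar>0\<bar> + C * \<bar>0\<bar>) (at 0)"
      using smooth_along_partial[OF assms, of n] unfolding smooth_along_def by (intro tendsto_intros)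
    then have "\<forall>\<^sub>F s in at 0. \<bar>?D n s / s\<bar> + C * \<bar>s\<bar> < \<epsilon> / 2"
      using \<open>0 < \<epsilon>\<close> by (intro order_tendstoD) auto
    moreover have "\<forall>\<^sub>F s in at 0. s \<noteq> (0::real)" by (simp add: eventually_at_filter)
    ultimately show "\<forall>\<^sub>F s in at 0. dist (?L s / s) 0 < \<epsilon>"
    proof eventually_elim
      case (elim s)
      have "?L s / \<bar>s\<bar> \<le> (?D n s + 2 * \<bar>s\<bar> * tail n h + C * s\<^sup>2) / \<bar>s\<bar>"
        using le by (intro divide_right_mono) auto
      also have "\<dots> = \<bar>?D n s / s\<bar> + C * \<bar>s\<bar> + 2 * tail n h"
        using elim(2) partial_second_difference_nonneg[of n x s h]
        by (simp add: abs_divide add_divide_distrib power2_eq_square) (simp add: abs_if)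
      finally have "?L s / \<bar>s\<bar> < \<epsilon>" using elim(1) n by linarith
      then show ?case using L[of s] by (simp add: abs_divide)
    qed
  qed
qed

section \<open>Octahedrality of the limit\<close>

lemma limit_add_scaleR_lower:
  assumes e: "\<And>j. f j e = (if j = n then 1 else 0)"
  shows "limit y + \<bar>\<beta>\<bar> - (2 * tail n y + (1/2) ^ Suc n * limit y + \<bar>\<beta>\<bar> * N\<^sub>0 e)
    \<le> limit (y + \<beta> *\<^sub>R e)"
proof -
  define \<delta> :: real where "\<delta> = (1/2) ^ Suc n"
  have \<delta>: "0 \<le> \<delta>" "\<delta> \<le> 1" using weight by (auto simp: \<delta>_def)
  \<comment> \<open>The coordinates of \<open>e\<close> below \<open>n\<close> vanish, and a layer
    with zero coordinate changes nothing. Hence adding a multiple of \<open>e\<close> costs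
    \<open>partial n\<close> only the small amount measured by \<open>N\<^sub>0 e\<close>.\<close>
  have "partial m e = N\<^sub>0 e" if "m \<le> n" for m
    using that by (induction m) (auto simp: e is_norm_nonneg[OF base])
  then have "partial n y - \<bar>\<beta>\<bar> * N\<^sub>0 e \<le> partial n (y + \<beta> *\<^sub>R e)"
    using is_normD(2)[OF is_norm_partial, of n "y + \<beta> *\<^sub>R e" "- (\<beta> *\<^sub>R e)"]
      is_norm_minus[OF is_norm_partial, of n "\<beta> *\<^sub>R e"] is_normD(3)[OF is_norm_partial, of n \<beta> e] by simp
  then have "(1 - \<delta>) * (partial n y - \<bar>\<beta>\<bar> * N\<^sub>0 e) \<le> (1 - \<delta>) * partial n (y + \<beta> *\<^sub>R e)"
    using \<delta> by (intro mult_left_mono) auto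
  \<comment> \<open>Layer \<open>n\<close> sees \<open>\<beta>\<close> at almost full weight, and
    later layers can only increase the value.\<close>
  moreover have "(1 - \<delta>) * partial n (y + \<beta> *\<^sub>R e) + \<bar>f n y + \<beta>\<bar> \<le> limit (y + \<beta> *\<^sub>R e)"
    using layer_lower[of \<delta> "partial n (y + \<beta> *\<^sub>R e)" "f n (y + \<beta> *\<^sub>R e)"]
      partial_le_limit[of "Suc n" "y + \<beta> *\<^sub>R e"] by (simp add: \<delta>_def e)
  moreover have "\<delta> * partial n y \<le> \<delta> * limit y"
    using \<delta> partial_le_limit by (intro mult_left_mono) auto
  moreover have "0 \<le> \<delta> * (\<bar>\<beta>\<bar> * N\<^sub>0 e)" using \<delta> is_norm_nonneg[OF base] by simp
  ultimately show ?thesis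
    \<comment> \<open>The tail is paid twice: once for replacing \<open>partial n y\<close> by
      \<open>limit y\<close>, once for the coordinate \<open>f n y\<close> that may cancel against
      \<open>\<beta>\<close>.\<close>
    using limit_le[of y n] abs_f_le_tail[of n y] unfolding \<delta>_def[symmetric]
    by (simp add: algebra_simps)
qed

text \<open>The witness is \<open>e n\<close>, normalized, for large \<open>n\<close>. The tail and
  the weight each cost at most \<open>\<epsilon> / 2\<close> times \<open>limit y\<close>; the value
  \<open>N\<^sub>0 (e n)\<close> and the normalization affect only the coefficient of
  \<open>e n\<close>.\<close>

lemma octahedral_limit:
  assumes e: "\<And>n j. f j (e n) = (if j = n then 1 else 0)"
    and null: "(\<lambda>n. N\<^sub>0 (e n)) \<longlonglongrightarrow> 0"
    and bound: "\<And>x. tail 0 x \<le> C * norm x"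
    and equiv: "0 < c" "\<And>x. c * norm x \<le> limit x"
  shows "octahedral limit"
  unfolding octahedral_def
proof (intro allI impI, elim conjE exE)
  fix \<epsilon> :: real and F B :: "'a set" assume "0 < \<epsilon>" and "finite B" and F: "span B = F"
  \<comment> \<open>With \<open>c * norm y \<le> limit y\<close>, twice this bound is at most
    \<open>\<epsilon> / 2 * limit y\<close>.\<close>
  have "\<forall>\<^sub>F n in sequentially. \<forall>y\<in>span B. tail n y \<le> (c * \<epsilon> / 4) * norm y"
    using \<open>finite B\<close> \<open>0 < \<epsilon>\<close> equiv(1) order_trans[OF tail_le bound]
    by (intro seminorms_uniformly_null_on_span tail_add tail_scaleR tail_tendsto_0) auto
  moreover have "\<forall>\<^sub>F n in sequentially. (1/2) ^ Suc n < \<epsilon> / 2"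
    using \<open>0 < \<epsilon>\<close> by (intro order_tendstoD(2)[OF LIMSEQ_Suc[OF LIMSEQ_power_zero]]) auto
  \<comment> \<open>The bound \<open>\<epsilon> / 2\<close> serves the case
    \<open>\<epsilon> \<le> 1\<close>, the bound 1 the case \<open>\<epsilon> > 1\<close>, where
    \<open>1 - \<eta>\<close> must not be negative.\<close>
  moreover have "\<forall>\<^sub>F n in sequentially. N\<^sub>0 (e n) < min 1 (\<epsilon> / 2)"
    using \<open>0 < \<epsilon>\<close> by (intro order_tendstoD(2)[OF null]) auto
  ultimately have "\<forall>\<^sub>F n in sequentially. (\<forall>y\<in>span B. tail n y \<le> (c * \<epsilon> / 4) * norm y) \<and>
      (1/2) ^ Suc n < \<epsilon> / 2 \<and> N\<^sub>0 (e n) < min 1 (\<epsilon> / 2)"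
    by eventually_elim blast
  then obtain n where tail: "\<And>y. y \<in> F \<Longrightarrow> tail n y \<le> (c * \<epsilon> / 4) * norm y"
      and \<delta>: "(1/2) ^ Suc n < \<epsilon> / 2" and small: "N\<^sub>0 (e n) < min 1 (\<epsilon> / 2)"
    using F unfolding eventually_sequentially by blast
  define \<eta> where "\<eta> = N\<^sub>0 (e n)"
  define r where "r = limit (e n)"
  have "tail (Suc n) (e n) = 0" by (simp add: tail_def e)
  then have "r \<le> partial n (e n) + 1"
    using limit_le[of "e n" n] tail_Suc[of n "e n"] by (simp add: r_def e)
  moreover have "partial m (e n) = \<eta>" if "m \<le> n" for m
    using that by (induction m) (auto simp: e is_norm_nonneg[OF base] \<eta>_def)
  ultimately have r: "r \<le> 1 + \<eta>" by simp
  have "e n \<noteq> 0" using e[of n n] by auto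
  then have "0 < r" using is_normD(1)[OF is_norm_limit, of "e n"] is_norm_nonneg[OF is_norm_limit, of "e n"]
    by (simp add: r_def)
  show "\<exists>x. limit x = 1 \<and> (\<forall>y\<in>F. \<forall>\<alpha>. (1 - \<epsilon>) * (limit y + \<bar>\<alpha>\<bar>) \<le> limit (y + \<alpha> *\<^sub>R x))"
  proof (intro exI[of _ "e n /\<^sub>R r"] conjI ballI allI)
    show "limit (e n /\<^sub>R r) = 1"
      using \<open>0 < r\<close> by (simp add: is_normD(3)[OF is_norm_limit] r_def)
    fix y \<alpha> assume "y \<in> F"
    define b where "b = \<bar>\<alpha>\<bar> / r"
    have b: "0 \<le> b" "\<bar>\<alpha>\<bar> = b * r" using \<open>0 < r\<close> by (auto simp: b_def)
    have ly: "0 \<le> limit y" by (rule is_norm_nonneg[OF is_norm_limit])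
    have "2 * tail n y \<le> \<epsilon> / 2 * limit y"
    proof -
      have "2 * tail n y \<le> \<epsilon> / 2 * (c * norm y)" using tail[OF \<open>y \<in> F\<close>] by (simp add: mult_ac)
      also have "\<dots> \<le> \<epsilon> / 2 * limit y" using equiv \<open>0 < \<epsilon>\<close> by (intro mult_left_mono) auto
      finally show ?thesis .
    qed
    moreover have "(1/2) ^ Suc n * limit y \<le> \<epsilon> / 2 * limit y"
      using \<delta> ly by (intro mult_right_mono) auto
    \<comment> \<open>This absorbs both the normalization by \<open>r\<close>, at most
      \<open>1 + \<eta>\<close>, and the loss \<open>b * \<eta>\<close> into the factor
      \<open>1 - \<epsilon>\<close>.\<close>
    moreover have "(1 - \<epsilon>) * r \<le> 1 - \<eta>"
    proof (cases "\<epsilon> \<le> 1")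
      case True
      then have "(1 - \<epsilon>) * r \<le> (1 - \<epsilon>) * (1 + \<eta>)" using r by (intro mult_left_mono) auto
      also have "\<dots> \<le> 1 - \<eta>"
        using small \<open>0 < \<epsilon>\<close> is_norm_nonneg[OF base, of "e n"] by (simp add: \<eta>_def algebra_simps)
          (smt (verit) mult_nonneg_nonneg)
      finally show ?thesis .
    next
      case False
      then have "(1 - \<epsilon>) * r \<le> 0" using \<open>0 < r\<close> by (intro mult_nonpos_nonneg) auto
      then show ?thesis using small by (simp add: \<eta>_def)
    qed
    then have "(1 - \<epsilon>) * r * b \<le> (1 - \<eta>) * b" using b by (intro mult_right_mono) auto
    moreover have "(1 - \<eta>) * b = b - b * \<eta>" by (simp add: algebra_simps)
    moreover have "limit y + b - (2 * tail n y + (1/2) ^ Suc n * limit y + b * \<eta>) \<le> limit (y + (\<alpha> / r) *\<^sub>R e n)"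
      using limit_add_scaleR_lower[of "e n" n y "\<alpha> / r", OF e] \<open>0 < r\<close> by (simp add: b_def \<eta>_def)
    ultimately have "limit y - \<epsilon> * limit y + (1 - \<epsilon>) * r * b \<le> limit (y + (\<alpha> / r) *\<^sub>R e n)"
      by linarith
    moreover have "(1 - \<epsilon>) * (limit y + \<bar>\<alpha>\<bar>) = limit y - \<epsilon> * limit y + (1 - \<epsilon>) * r * b"
      unfolding b(2) by (simp add: algebra_simps)
    moreover have "\<alpha> *\<^sub>R (e n /\<^sub>R r) = (\<alpha> / r) *\<^sub>R e n" by (simp add: divide_inverse mult.commute)
    ultimately show "(1 - \<epsilon>) * (limit y + \<bar>\<alpha>\<bar>) \<le> limit (y + \<alpha> *\<^sub>R (e n /\<^sub>R r))"
      by (simp only:)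
  qed
qed

end

section \<open>The coordinates of the complemented subspace\<close>

lift_definition unit_ell1 :: "nat \<Rightarrow> ell1" is "\<lambda>n j. if j = n then 1 else 0"
  by (rule summable_finite[of "{n}" for n]) auto

lemma abs_divide_power2_le: "\<bar>a / 2 ^ n\<bar> \<le> \<bar>a::real\<bar>"
  using mult_left_mono[of 1 "2 ^ n" "\<bar>a\<bar>"] by (simp add: abs_divide field_simps)

lift_definition damp_ell1 :: "ell1 \<Rightarrow> ell1" is "\<lambda>f n. f n / 2 ^ n"
proof -
  fix f :: "nat \<Rightarrow> real" assume "summable (\<lambda>n. \<bar>f n\<bar>)"
  then show "summable (\<lambda>n. \<bar>f n / 2 ^ n\<bar>)"
    by (rule summable_comparison_test'[of _ 0]) (simp only: real_norm_def abs_idempotent abs_divide_power2_le)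
qed

lemma summable_Rep_ell1: "summable (\<lambda>n. \<bar>Rep_ell1 v n\<bar>)"
  by transfer simp

lemma norm_damp_ell1_le: "norm (damp_ell1 v) \<le> norm v"
proof transfer
  fix f :: "nat \<Rightarrow> real" assume f: "summable (\<lambda>n. \<bar>f n\<bar>)"
  then have "summable (\<lambda>n. \<bar>f n / 2 ^ n\<bar>)"
    by (rule summable_comparison_test'[of _ 0]) (simp only: real_norm_def abs_idempotent abs_divide_power2_le)
  then show "(\<Sum>n. \<bar>f n / 2 ^ n\<bar>) \<le> (\<Sum>n. \<bar>f n\<bar>)"
    by (intro suminf_le abs_divide_power2_le f)
qed

lemma bounded_linear_damp_ell1: "bounded_linear damp_ell1"
proof (rule bounded_linear_intro)
  show "damp_ell1 (v + w) = damp_ell1 v + damp_ell1 w" for v w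
    by transfer (simp add: add_divide_distrib)
  show "damp_ell1 (c *\<^sub>R v) = c *\<^sub>R damp_ell1 v" for c v
    by transfer simp
  show "norm (damp_ell1 v) \<le> norm v * 1" for v
    using norm_damp_ell1_le by simp
qed

lemma damp_ell1_eq_0: "damp_ell1 v = 0 \<Longrightarrow> v = 0"
  by transfer (simp add: fun_eq_iff)

lemma damp_unit_ell1: "damp_ell1 (unit_ell1 n) = (1 / 2 ^ n) *\<^sub>R unit_ell1 n"
  by transfer auto

section \<open>A bounded left inverse of the embedding\<close>

lemma bounded_linear_of_linear_continuous_at_0:
  fixes f :: "'a::real_normed_vector \<Rightarrow> 'b::real_normed_vector"
  assumes "linear f" and "isCont f 0"
  shows "bounded_linear f"
proof -
  have "f 0 = 0" using assms(1) by (rule linear_0)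
  then obtain d where d: "d > 0" "\<And>x. norm x < d \<Longrightarrow> norm (f x) < 1"
    using assms(2) unfolding continuous_at_eps_delta by (metis dist_0_norm dist_norm diff_zero zero_less_one)
  have "norm (f x) \<le> norm x * (2 / d)" for x
  proof (cases "x = 0")
    case False
    define c where "c = d / (2 * norm x)"
    have c: "c > 0" using False d by (simp add: c_def)
    have "norm (c *\<^sub>R x) < d" using False d(1) by (simp add: c_def)
    then have "norm (f (c *\<^sub>R x)) < 1" by (rule d)
    then have "c * norm (f x) < 1" using c by (simp add: linear_cmul[OF assms(1)])
    then show ?thesis using False d(1) by (simp add: c_def field_simps)
  qed (simp add: \<open>f 0 = 0\<close>)
  then show ?thesis
    by (rule bounded_linear_intro[OF linear_add[OF assms(1)] linear_cmul[OF assms(1)]])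
qed

text \<open>The left inverse is the projection followed by the inverse homeomorphism, whose
  continuity gives boundedness once linearity is known.\<close>

lemma complemented_ell1_retraction:
  fixes Y :: "'a::real_normed_vector set"
  assumes "complemented_subspace Y" and "isomorphic_to_ell1 Y"
  shows "\<exists>(T :: ell1 \<Rightarrow> 'a) V. bounded_linear T \<and> bounded_linear V \<and> (\<forall>v. V (T v) = v)"
proof -
  obtain P where P: "bounded_linear P" "P \<circ> P = P" "range P = Y"
    using assms(1) by (auto simp: complemented_subspace_def)
  obtain T :: "ell1 \<Rightarrow> 'a" and S where T: "bounded_linear T" and hom: "homeomorphism UNIV Y T S"
    using assms(2) by (auto simp: isomorphic_to_ell1_def)
  interpret P: bounded_linear P by fact
  interpret T: bounded_linear T by fact
  have ST: "S (T v) = v" and TS: "y \<in> Y \<Longrightarrow> T (S y) = y" and TY: "T v \<in> Y" for v y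
    using hom by (auto simp: homeomorphism_def)
  have inj: "v = w" if "T v = T w" for v w using ST that by metis
  have PT: "P (T v) = T v" for v using TY[of v] P(2,3) by (auto simp: fun_eq_iff)
  define V where "V = S \<circ> P"
  have TV: "T (V x) = P x" for x using TS P(3) by (auto simp: V_def)
  \<comment> \<open>Linearity is tested after applying the injective \<open>T\<close>, where
    \<open>T (V x) = P x\<close> is linear in \<open>x\<close>.\<close>
  have "linear V"
    by (rule linearI; rule inj) (simp_all add: TV P.add P.scaleR T.add T.scaleR)
  moreover have "continuous_on UNIV V"
    unfolding V_def
  proof (rule continuous_on_compose)
    show "continuous_on UNIV P" by (rule linear_continuous_on[OF P(1)])
    show "continuous_on (range P) S" using hom P(3) by (simp add: homeomorphism_def)
  qed
  then have "isCont V 0" by (simp add: continuous_on_eq_continuous_at)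
  ultimately have "bounded_linear V" by (rule bounded_linear_of_linear_continuous_at_0)
  moreover have "V (T v) = v" for v by (simp add: V_def PT ST)
  ultimately show ?thesis using T by blast
qed

section \<open>Renorming the space\<close>

theorem theorem1p1:
  assumes "\<exists>N :: 'a::banach \<Rightarrow> real. equivalent_norm N \<and> gateaux_smooth N"
    and "\<exists>Y :: 'a set. complemented_subspace Y \<and> isomorphic_to_ell1 Y"
  shows "\<exists>N :: 'a \<Rightarrow> real. equivalent_norm N \<and> octahedral N \<and> gateaux_smooth N"
proof -
  obtain S :: "'a \<Rightarrow> real" and c C where S: "is_norm S" "gateaux_smooth S"
      and c: "0 < c" "\<And>x. c * norm x \<le> S x" and C: "0 < C" "\<And>x. S x \<le> C * norm x"
    using assms(1) by (auto simp: equivalent_norm_def)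
  obtain T :: "ell1 \<Rightarrow> 'a" and V where T: "bounded_linear T" and V: "bounded_linear V"
      and VT: "\<And>v. V (T v) = v"
    using assms(2) complemented_ell1_retraction by metis
  interpret T: bounded_linear T by fact
  interpret V: bounded_linear V by fact
  interpret D: bounded_linear damp_ell1 by (rule bounded_linear_damp_ell1)
  \<comment> \<open>\<open>x - T (V x)\<close> is the component in the kernel of \<open>V\<close>;
    only the other component is damped.\<close>
  define Q where "Q x = x - T (V x) + T (damp_ell1 (V x))" for x
  have Q: "bounded_linear Q"
    unfolding Q_def
    by (intro bounded_linear_add bounded_linear_sub bounded_linear_ident
        bounded_linear_compose[OF T] bounded_linear_compose[OF bounded_linear_damp_ell1] V)
  interpret Q: bounded_linear Q by fact
  have inj: "x = 0" if "Q x = 0" for x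
  proof -
    have "damp_ell1 (V x) = V (Q x)" by (simp add: Q_def V.add V.diff VT)
    then have "V x = 0" using that by (simp add: V.zero damp_ell1_eq_0)
    then show ?thesis using that by (simp add: Q_def T.zero D.zero)
  qed
  define f where "f n x = Rep_ell1 (V x) n" for n x
  define N\<^sub>0 where "N\<^sub>0 x = S (Q x)" for x
  interpret layered_norm N\<^sub>0 f
  proof (rule layered_norm.intro)
    show "is_norm N\<^sub>0"
      using is_normD[OF S(1)] inj Q.zero by (auto simp: is_norm_def N\<^sub>0_def Q.add Q.scaleR)
    show "linear (f n)" for n
      by (rule linearI) (simp_all add: f_def V.add V.scaleR plus_ell1.rep_eq scaleR_ell1.rep_eq)
    show "summable (\<lambda>n. \<bar>f n x\<bar>)" for x
      unfolding f_def by (rule summable_Rep_ell1)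
  qed
  have tail: "tail 0 x = norm (V x)" for x
    by (simp add: tail_def f_def norm_ell1.rep_eq)
  obtain K where K: "0 < K" "\<And>v. norm (T v) \<le> norm v * K" using T.pos_bounded by blast
  obtain L where L: "0 < L" "\<And>x. norm (V x) \<le> norm x * L" using V.pos_bounded by blast
  obtain M where M: "0 < M" "\<And>x. norm (Q x) \<le> norm x * M" using Q.pos_bounded by blast
  have upper: "limit x \<le> (C * M + L) * norm x" for x
  proof -
    have "N\<^sub>0 x \<le> C * (norm x * M)"
      unfolding N\<^sub>0_def using C(1) by (intro order_trans[OF C(2) mult_left_mono[OF M(2)]]) simp
    then show ?thesis using limit_le[of x 0] L(2)[of x] by (simp add: tail algebra_simps)
  qed
  \<comment> \<open>The reciprocal of \<open>2 / c + 4 * K\<close>, the constant in the estimate of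
    \<open>norm x\<close> by \<open>limit x\<close> below.\<close>
  define r where "r = 1 / (2 * (1 / c + 2 * K))"
  have r: "0 < r" using c(1) K(1) by (simp add: r_def add_pos_pos)
  have lower: "r * norm x \<le> limit x" for x
  proof -
    have l: "norm (Q x) \<le> 2 * limit x / c" "norm (V x) \<le> 2 * limit x"
    proof -
      have "c * norm (Q x) \<le> 2 * limit x"
        using c(2)[of "Q x"] limit_lower[of x] norm_ge_zero[of "V x"] unfolding N\<^sub>0_def tail by linarith
      then show "norm (Q x) \<le> 2 * limit x / c" using c(1) by (simp add: pos_le_divide_eq mult.commute)
      show "norm (V x) \<le> 2 * limit x"
        using limit_lower[of x] is_norm_nonneg[OF base, of x] unfolding tail by linarith
    qed
    have "norm (T (damp_ell1 (V x))) \<le> norm (V x) * K"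
      using K(1) by (intro order_trans[OF K(2) mult_right_mono[OF norm_damp_ell1_le]]) simp
    \<comment> \<open>Damping destroys any lower bound for \<open>Q\<close> alone, but
      \<open>x\<close> differs from \<open>Q x\<close> only by terms controlled by
      \<open>norm (V x)\<close>, which \<open>limit\<close> dominates.\<close>
    moreover have "norm x \<le> norm (Q x) + norm (T (V x)) + norm (T (damp_ell1 (V x)))"
      using norm_triangle_ineq4[of "Q x + T (V x)" "T (damp_ell1 (V x))"]
        norm_triangle_ineq[of "Q x" "T (V x)"] by (simp add: Q_def)
    moreover have "norm (V x) * K \<le> 2 * limit x * K" using l(2) K(1) by (intro mult_right_mono) auto
    ultimately have "norm x \<le> 2 * limit x / c + 2 * (2 * limit x * K)"
      using l(1) K(2)[of "V x"] by linarith
    also have "\<dots> = limit x / r" by (simp add: r_def algebra_simps)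
    finally show ?thesis using r by (simp add: pos_le_divide_eq mult.commute)
  qed
  have "equivalent_norm limit"
    unfolding equivalent_norm_def
    using is_norm_limit upper lower r C(1) M(1) L(1) by (meson add_pos_pos mult_pos_pos)
  moreover have "octahedral limit"
  proof (rule octahedral_limit)
    show "f j (T (unit_ell1 n)) = (if j = n then 1 else 0)" for j n
      by (simp add: f_def VT unit_ell1.rep_eq)
    have "N\<^sub>0 (T (unit_ell1 n)) = S (T (unit_ell1 n)) / 2 ^ n" for n
      by (simp add: N\<^sub>0_def Q_def VT damp_unit_ell1 T.scaleR is_normD(3)[OF S(1)])
    moreover have "S (T (unit_ell1 n)) \<le> C * K" for n
    proof -
      have "norm (unit_ell1 n) = 1"
        by transfer (subst suminf_finite[of "{n}" for n]; auto)
      then show ?thesis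
        using C(1) K(2)[of "unit_ell1 n"] by (intro order_trans[OF C(2) mult_left_mono]) auto
    qed
    ultimately have "norm (N\<^sub>0 (T (unit_ell1 n))) \<le> C * K * (1/2) ^ n" for n
      using is_norm_nonneg[OF base, of "T (unit_ell1 n)"]
        divide_right_mono[of "S (T (unit_ell1 n))" "C * K" "2 ^ n"] by (simp add: power_divide)
    moreover have "(\<lambda>n. C * K * (1/2) ^ n) \<longlonglongrightarrow> 0"
      by (intro tendsto_mult_right_zero LIMSEQ_power_zero) simp
    ultimately show "(\<lambda>n. N\<^sub>0 (T (unit_ell1 n))) \<longlonglongrightarrow> 0"
      by (rule Lim_null_comparison[OF always_eventually[OF allI]])
    show "tail 0 x \<le> L * norm x" for x using L(2) by (simp add: tail mult.commute)
  qed (use r lower in auto)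
  moreover have "gateaux_smooth limit"
    unfolding gateaux_smooth_def
  proof (intro allI impI)
    fix x :: 'a assume "x \<noteq> 0"
    have "smooth_along N\<^sub>0 x h" for h
    proof -
      \<comment> \<open>Injectivity keeps \<open>Q x\<close> away from 0, and the second difference
        of \<open>N\<^sub>0\<close> at \<open>x\<close> along \<open>h\<close> is that of
        \<open>S\<close> at \<open>Q x\<close> along \<open>Q h\<close>.\<close>
      have "gateaux_differentiable S (Q x)"
        using S(2) inj \<open>x \<noteq> 0\<close> unfolding gateaux_smooth_def by blast
      then show ?thesis
        using gateaux_differentiable_imp_smooth_along[of S "Q x" "Q h"]
        by (simp add: smooth_along_def N\<^sub>0_def Q.add Q.diff Q.scaleR)
    qed
    then show "gateaux_differentiable limit x"
      using \<open>x \<noteq> 0\<close> by (intro smooth_along_imp_gateaux_differentiable[OF is_norm_limit upper]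
          smooth_along_limit)
  qed
  ultimately show ?thesis by blast
qed

end
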